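(* Let $M$ be a reduced, finitely generated monoid with set of irreducible elements $G=\{u_1,\ldots,u_k\}$. For every $x\in\mathsf q(M)$ with $\omega(x)>0$, $$\operatorname{bul}(x)=\Big\{\mathbf b\in\mathsf Z_A(y+x)\;:\;\emptyset\neq A\subset G\ \text{ and }\ y\in\bigcap_{u_i\in A}\operatorname{Ap}(M;u_i)\Big\}.$$
   Context: All monoids are commutative, cancellative and atomic, written additively; reduced means that $0$ is the only unit. An element is irreducible if it is a non-unit that is not a sum of two non-units. $\mathsf q(M)$ denotes the quotient group (group of differences) of $M$, with $M\subset\mathsf q(M)$; $\mathbb N$ includes $0$. Factorizations: for $z\in M$, $\mathsf Z(z)=\{\mathbf a\in\mathbb N^k: a_1u_1+\cdots+a_ku_k=z\}$, and $\mathsf Z(z)=\emptyset$ for $z\in\mathsf q(M)\setminus M$. For nonempty $A\subset G$, $\mathsf Z_A(z)=\{\mathbf a\in\mathsf Z(z): a_i=0\text{ whenever }u_i\notin A\}$. Apéry set: for $u\in M$, $\operatorname{Ap}(M;u)=\{m\in M: m-u\in\mathsf q(M)\setminus M\}$. Bullets: for $x\in\mathsf q(M)$, a bullet for $x$ is a tuple $\mathbf b=(b_1,\ldots,b_k)\in\mathbb N^k$ such that (i) $\sum_j b_ju_j-x\in M$, and (ii) $\sum_j b_ju_j-x-u_i\notin M$ for each $i$ with $b_i>0$. The set of bullets of $x$ is $\operatorname{bul}(x)$. $\omega$-primality: for $x\in\mathsf q(M)$, $\omega(x)$ is the smallest nonnegative integer $m$ with the property that whenever $\sum_{i=1}^r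 a_i-x\in M$ with $r>m$ and $a_i\in M$, there is a subset $T\subset\{1,\ldots,r\}$ with $|T|\le m$ such that $\sum_{i\in T}a_i-x\in M$; if no such $m$ exists, $\omega(x)=\infty$. *)

theory Defs
  imports "HOL-Library.FuncSet" "HOL-Library.Extended_Nat"
begin

text \<open>The library class \<open>cancel_comm_monoid_add\<close> also carries a subtraction operation,
  which is not part of the structure of a cancellative monoid.\<close>

class cancellative_comm_monoid = comm_monoid_add +
  assumes left_cancel: "a + b = a + c \<Longrightarrow> b = c"

definition monoid_unit :: "'m::cancellative_comm_monoid \<Rightarrow> bool" where
  "monoid_unit a \<longleftrightarrow> (\<exists>b. a + b = 0)"

definition irreds :: "'m::cancellative_comm_monoid set" where
  "irreds = {a. \<not> monoid_unit a \<and>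
     \<not> (\<exists>b c. \<not> monoid_unit b \<and> \<not> monoid_unit c \<and> a = b + c)}"

definition reduced_monoid :: "'m::cancellative_comm_monoid itself \<Rightarrow> bool" where
  "reduced_monoid _ \<longleftrightarrow> (\<forall>a::'m. monoid_unit a \<longleftrightarrow> a = 0)"

definition atomic_monoid :: "'m::cancellative_comm_monoid itself \<Rightarrow> bool" where
  "atomic_monoid _ \<longleftrightarrow>
     (\<forall>a::'m. \<not> monoid_unit a \<longrightarrow> (\<exists>us. set us \<subseteq> irreds \<and> a = sum_list us))"

definition fin_gen_monoid :: "'m::cancellative_comm_monoid itself \<Rightarrow> bool" where
  "fin_gen_monoid _ \<longleftrightarrow>
     (\<exists>S::'m set. finite S \<and> (\<forall>a. \<exists>us. set us \<subseteq> S \<and> a = sum_list us))"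

definition diff_rel :: "'m::cancellative_comm_monoid \<times> 'm \<Rightarrow> 'm \<times> 'm \<Rightarrow> bool" where
  "diff_rel p q \<longleftrightarrow> fst p + snd q = fst q + snd p"

lemma equivp_diff_rel: "equivp (diff_rel :: 'a::cancellative_comm_monoid \<times> 'a \<Rightarrow> _)"
proof (rule equivpI)
  show "reflp (diff_rel :: 'a \<times> 'a \<Rightarrow> _)" by (simp add: reflp_def diff_rel_def)
  show "symp (diff_rel :: 'a \<times> 'a \<Rightarrow> _)" by (simp add: symp_def diff_rel_def)
  show "transp (diff_rel :: 'a \<times> 'a \<Rightarrow> _)"
  proof (rule transpI)
    fix p q r :: "'a \<times> 'a"
    assume pq: "diff_rel p q" and qr: "diff_rel q r"
    have "snd q + (fst p + snd r) = (fst p + snd q) + snd r"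
      by (simp add: ac_simps)
    also have "\<dots> = (fst q + snd r) + snd p"
      using pq by (simp add: diff_rel_def ac_simps)
    also have "\<dots> = snd q + (fst r + snd p)"
      using qr by (simp add: diff_rel_def ac_simps)
    finally show "diff_rel p r"
      unfolding diff_rel_def by (rule left_cancel)
  qed
qed

text \<open>The class of \<open>(a, b)\<close> is the formal difference \<open>a - b\<close>.\<close>

quotient_type (overloaded) 'm quotient_group =
  "'m::cancellative_comm_monoid \<times> 'm" / diff_rel
  by (rule equivp_diff_rel)

instantiation quotient_group :: (cancellative_comm_monoid) ab_group_add
begin

lift_definition zero_quotient_group :: "'a quotient_group" is "(0, 0)" .

lift_definition plus_quotient_group ::
  "'a quotient_group \<Rightarrow> 'a quotient_group \<Rightarrow> 'a quotient_group"
  is "\<lambda>p q. (fst p + fst q, snd p + snd q)"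
proof -
  fix p p' q q' :: "'a \<times> 'a"
  assume pp: "diff_rel p p'" and qq: "diff_rel q q'"
  have "(fst p + fst q) + (snd p' + snd q') = (fst p + snd p') + (fst q + snd q')"
    by (simp add: ac_simps)
  also have "\<dots> = (fst p' + snd p) + (fst q' + snd q)"
    using pp qq by (simp add: diff_rel_def)
  also have "\<dots> = (fst p' + fst q') + (snd p + snd q)"
    by (simp add: ac_simps)
  finally show "diff_rel (fst p + fst q, snd p + snd q) (fst p' + fst q', snd p' + snd q')"
    by (simp add: diff_rel_def)
qed

lift_definition uminus_quotient_group :: "'a quotient_group \<Rightarrow> 'a quotient_group"
  is "\<lambda>p. (snd p, fst p)"
  by (simp add: diff_rel_def ac_simps)

definition minus_quotient_group ::
  "'a quotient_group \<Rightarrow> 'a quotient_group \<Rightarrow> 'a quotient_group" where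
  "minus_quotient_group x y = x + - y"

instance
proof
  fix x y z :: "'a quotient_group"
  show "x + y + z = x + (y + z)" by transfer (simp add: diff_rel_def ac_simps)
  show "x + y = y + x" by transfer (simp add: diff_rel_def ac_simps)
  show "0 + x = x" by transfer (simp add: diff_rel_def)
  show "- x + x = 0" by transfer (simp add: diff_rel_def ac_simps)
  show "x - y = x + - y" by (rule minus_quotient_group_def)
qed

end

lift_definition emb :: "'m::cancellative_comm_monoid \<Rightarrow> 'm quotient_group"
  is "\<lambda>a. (a, 0)" .

text \<open>Under the inclusion of the monoid in its quotient group, membership in the monoid
  becomes membership in \<open>range emb\<close>.\<close>

abbreviation monoid_part :: "'m::cancellative_comm_monoid quotient_group set" ("\<M>") where
  "\<M> \<equiv> range emb"

lemma emb_zero: "emb 0 = 0"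
  by transfer (simp add: diff_rel_def)

lemma emb_add: "emb (a + b) = emb a + emb b"
  by transfer (simp add: diff_rel_def)

lemma inj_emb: "inj emb"
  by (rule injI, transfer) (simp add: diff_rel_def)

lemma quotient_group_eq_diff: "\<exists>a b. x = emb a - emb b"
  unfolding minus_quotient_group_def by transfer (auto simp: diff_rel_def)

primrec nmult :: "nat \<Rightarrow> 'm::cancellative_comm_monoid \<Rightarrow> 'm" where
  "nmult 0 a = 0"
| "nmult (Suc n) a = a + nmult n a"

text \<open>\<open>\<nat>\<^sup>k\<close>: extensional functions, so that equality of tuples is equality of functions.\<close>

definition tuples :: "nat \<Rightarrow> (nat \<Rightarrow> nat) set" where
  "tuples k = {1..k} \<rightarrow>\<^sub>E UNIV"

definition comb :: "nat \<Rightarrow> (nat \<Rightarrow> 'm::cancellative_comm_monoid) \<Rightarrow> (nat \<Rightarrow> nat) \<Rightarrow> 'm" where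
  "comb k u a = (\<Sum>i=1..k. nmult (a i) (u i))"

definition factorizations ::
  "nat \<Rightarrow> (nat \<Rightarrow> 'm::cancellative_comm_monoid) \<Rightarrow> 'm quotient_group \<Rightarrow> (nat \<Rightarrow> nat) set" where
  "factorizations k u z = {a \<in> tuples k. emb (comb k u a) = z}"

lemma factorizations_outside: "z \<notin> \<M> \<Longrightarrow> factorizations k u z = {}"
  by (auto simp: factorizations_def)

definition factorizations_in ::
  "nat \<Rightarrow> (nat \<Rightarrow> 'm::cancellative_comm_monoid) \<Rightarrow> 'm set \<Rightarrow> 'm quotient_group
    \<Rightarrow> (nat \<Rightarrow> nat) set" where
  "factorizations_in k u A z =
     {a \<in> factorizations k u z. \<forall>i\<in>{1..k}. u i \<notin> A \<longrightarrow> a i = 0}"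

definition Apery :: "'m::cancellative_comm_monoid \<Rightarrow> 'm set" where
  "Apery u = {m. emb m - emb u \<notin> \<M>}"

definition bullets ::
  "nat \<Rightarrow> (nat \<Rightarrow> 'm::cancellative_comm_monoid) \<Rightarrow> 'm quotient_group \<Rightarrow> (nat \<Rightarrow> nat) set" where
  "bullets k u x =
     {b \<in> tuples k. emb (comb k u b) - x \<in> \<M> \<and>
        (\<forall>i\<in>{1..k}. b i > 0 \<longrightarrow> emb (comb k u b) - x - emb (u i) \<notin> \<M>)}"

definition omega_bound :: "'m::cancellative_comm_monoid quotient_group \<Rightarrow> nat \<Rightarrow> bool" where
  "omega_bound x m \<longleftrightarrow>
     (\<forall>r (a :: nat \<Rightarrow> 'm). r > m \<and> emb (\<Sum>i=1..r. a i) - x \<in> \<M> \<longrightarrow>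
        (\<exists>T \<subseteq> {1..r}. card T \<le> m \<and> emb (\<Sum>i\<in>T. a i) - x \<in> \<M>))"

definition omega :: "'m::cancellative_comm_monoid quotient_group \<Rightarrow> enat" where
  "omega x = (if \<exists>m. omega_bound x m then enat (LEAST m. omega_bound x m) else \<infinity>)"

end

theory Submission imports Defs begin

text \<open>A tuple \<open>b\<close> with value \<open>s = b\<^sub>1 u\<^sub>1 + \<dots> + b\<^sub>k u\<^sub>k\<close> is tied to \<open>x\<close> by the remainder \<open>y = s - x\<close>.
  Condition (i) on a bullet says that \<open>y\<close> lies in the monoid, so that \<open>b\<close> is a factorization of
  \<open>y + x\<close>; condition (ii) says that \<open>y\<close> lies in the Apery set of every irreducible in the support
  of \<open>b\<close>. Hence the set \<open>A\<close> can always be taken to be the support of \<open>b\<close>, and any larger choice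
  of \<open>A\<close> only strengthens the requirement on \<open>y\<close>.

  The support must be nonempty, and \<open>\<omega>(x) > 0\<close> ensures this: if the zero tuple were
  a bullet, then \<open>-x\<close> would lie in the monoid, the empty subsum would always suffice, and
  \<open>\<omega>(x)\<close> would be \<open>0\<close>.\<close>

lemma omega_pos_imp_uminus_notin:
  fixes x :: "'m::cancellative_comm_monoid quotient_group"
  assumes "omega x > 0"
  shows "- x \<notin> \<M>"
proof
  assume "- x \<in> \<M>"
  then have "omega_bound x 0"
    unfolding omega_bound_def by (intro allI impI exI[of _ "{}"]) (simp add: emb_zero)
  then have "omega x = 0"
    unfolding omega_def by (auto simp: zero_enat_def intro!: Least_eq_0)
  with assms show False by simp
qed

lemma comb_eq_0:
  fixes u :: "nat \<Rightarrow> 'm::cancellative_comm_monoid"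
  assumes "\<And>i. i \<in> {1..k} \<Longrightarrow> b i = 0"
  shows "comb k u b = 0"
  unfolding comb_def using assms by (simp add: sum.neutral)

lemma bullet_support_nonempty:
  fixes u :: "nat \<Rightarrow> 'm::cancellative_comm_monoid"
  assumes "b \<in> bullets k u x" and "omega x > 0"
  obtains i where "i \<in> {1..k}" and "b i > 0"
proof (rule ccontr)
  assume "\<not> thesis"
  then have "comb k u b = 0"
    using that by (intro comb_eq_0) blast
  then have "- x \<in> \<M>"
    using assms(1) by (simp add: bullets_def emb_zero)
  with omega_pos_imp_uminus_notin[OF assms(2)] show False by contradiction
qed

lemma bullets_iff_support_Apery:
  "b \<in> bullets k u x \<longleftrightarrow>
     (\<exists>y. b \<in> factorizations k u (emb y + x) \<and>
          (\<forall>i\<in>{1..k}. b i > 0 \<longrightarrow> y \<in> Apery (u i)))"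
proof
  assume b: "b \<in> bullets k u x"
  then obtain y where y: "emb (comb k u b) - x = emb y"
    unfolding bullets_def by blast
  then have "emb (comb k u b) = emb y + x"
    by (simp only: diff_eq_eq)
  with b y show "\<exists>y. b \<in> factorizations k u (emb y + x) \<and>
      (\<forall>i\<in>{1..k}. b i > 0 \<longrightarrow> y \<in> Apery (u i))"
    by (intro exI[of _ y]) (simp add: bullets_def factorizations_def Apery_def)
next
  assume "\<exists>y. b \<in> factorizations k u (emb y + x) \<and>
      (\<forall>i\<in>{1..k}. b i > 0 \<longrightarrow> y \<in> Apery (u i))"
  then show "b \<in> bullets k u x"
    by (auto simp: bullets_def factorizations_def Apery_def)
qed

theorem theorem6p2:
  fixes u :: "nat \<Rightarrow> 'm::cancellative_comm_monoid"
    and k :: nat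
    and x :: "'m quotient_group"
  assumes "reduced_monoid TYPE('m)"
    and "atomic_monoid TYPE('m)"
    and "fin_gen_monoid TYPE('m)"
    and "bij_betw u {1..k} irreds"
    and "omega x > 0"
  shows "bullets k u x =
    {b. \<exists>A y. A \<noteq> {} \<and> A \<subseteq> irreds \<and> y \<in> (\<Inter>v\<in>A. Apery v)
          \<and> b \<in> factorizations_in k u A (emb y + x)}"
    (is "_ = ?R")
proof (intro subset_antisym subsetI)
  fix b assume b: "b \<in> bullets k u x"
  then obtain y where y: "b \<in> factorizations k u (emb y + x)"
      "\<forall>i\<in>{1..k}. b i > 0 \<longrightarrow> y \<in> Apery (u i)"
    unfolding bullets_iff_support_Apery by blast
  obtain j where j: "j \<in> {1..k}" "b j > 0"
    using bullet_support_nonempty[OF b assms(5)] .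
  define A where "A = u ` {i \<in> {1..k}. b i > 0}"
  have "A \<noteq> {}"
    using j unfolding A_def by blast
  moreover have "A \<subseteq> irreds"
    using bij_betw_imp_surj_on[OF assms(4)] unfolding A_def by blast
  moreover have "y \<in> (\<Inter>v\<in>A. Apery v)"
    using y(2) unfolding A_def by blast
  moreover have "b \<in> factorizations_in k u A (emb y + x)"
    using y(1) unfolding factorizations_in_def A_def by auto
  ultimately show "b \<in> ?R" by blast
next
  fix b assume "b \<in> ?R"
  then obtain A y where "y \<in> (\<Inter>v\<in>A. Apery v)" "b \<in> factorizations_in k u A (emb y + x)"
    by blast
  then show "b \<in> bullets k u x"
    unfolding bullets_iff_support_Apery factorizations_in_def by fastforce
qed

end
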